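(* Let $q$ be a prime power and $n=u_1^{a_1}u_2^{a_2}\cdots u_t^{a_t}$, where $u_1,\dots,u_t$ are pairwise distinct primes and $a_1,\dots,a_t$ are nonnegative integers. Let $\alpha$ be a primitive element of $\mathbb{F}_{q^n}$, and let $C$ be the $q$-ary simplex code of length $N=q^n-1$, $$C=\left\{\left(\mathrm{Tr}_{\mathbb{F}_{q^n}/\mathbb{F}_q}(\lambda\alpha^k)\right)_{0\le k\le N-1}:\lambda\in\mathbb{F}_{q^n}\right\}.$$ For $\vec{i}=(i_1,\dots,i_t)\in\prod_{1\le j\le t}\{0,1,\dots,a_j\}$ put $$L_{\vec{i}}=\frac{q^n-1}{q^{u_1^{i_1}\cdots u_t^{i_t}}-1}.$$ Then for any such $\vec{i}$ (with $\vec{i}=(0,\dots,0)$ excluded if $q=2$), $C$ has exactly $$N\left(u_1^{a_1-i_1}\cdots u_t^{a_t-i_t},\,q^{u_1^{i_1}\cdots u_t^{i_t}}\right)-\sum_{1\le j\le t}N_{\vec{i}}(j)+\sum_{1\le j_1<j_2\le t}N_{\vec{i}}(j_1,j_2)-\cdots-(-1)^{t-1}N_{\vec{i}}(1,2,\dots,t)$$ nonzero quasi-cyclic subcodes of index $L_{\vec{i}}$.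
   Context: A linear code $D\subseteq\mathbb{F}_q^N$ is quasi-cyclic of index $\ell$ if it is invariant under cyclic shift of codewords by $\ell$ positions and $\ell$ is the smallest positive integer with this property; index $1$ means cyclic. Subcodes are $\mathbb{F}_q$-linear, and the zero code is not counted. For a prime power $Q$ and $m\ge 1$, $N(m,Q)$ denotes the number of nonzero $\mathbb{F}_Q$-subspaces of an $m$-dimensional $\mathbb{F}_Q$-vector space: $$N(m,Q)=\sum_{k=1}^{m}\frac{(Q^m-1)(Q^m-Q)\cdots(Q^m-Q^{k-1})}{(Q^k-1)(Q^k-Q)\cdots(Q^k-Q^{k-1})}.$$ For $J=\{j_1<\cdots<j_v\}\subseteq\{1,\dots,t\}$ nonempty, define $$N_{\vec{i}}(j_1,\dots,j_v)=N\left(\prod_{j\in J}u_j^{a_j-i_j-1}\prod_{\mu\notin J}u_\mu^{a_\mu-i_\mu},\; q^{\prod_{j\in J}u_j^{i_j+1}\prod_{\mu\notin J}u_\mu^{i_\mu}}\right)$$ if $i_j+1\le a_j$ for all $j\in J$, and $N_{\vec{i}}(j_1,\dots,j_v)=0$ if $i_j+1>a_j$ for some $j\in J$. *)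

theory Defs
  imports
    Complex_Main
    "HOL-Number_Theory.Prime_Powers"
    "Jordan_Normal_Form.Matrix"
begin

text \<open>
  The field with \<open>q ^ n\<close> elements is a type of class \<open>{field, finite}\<close>, and the field with \<open>q\<close>
  elements is a subfield of it, given as a set \<open>K\<close>. Words of length \<open>N\<close> over \<open>K\<close> are vectors
  of dimension \<open>N\<close> all of whose entries lie in \<open>K\<close>.
\<close>

definition is_subfield :: "'a::field set \<Rightarrow> bool" where
  "is_subfield K \<longleftrightarrow> 0 \<in> K \<and> 1 \<in> K \<and>
     (\<forall>x\<in>K. \<forall>y\<in>K. x + y \<in> K \<and> x * y \<in> K) \<and> (\<forall>x\<in>K. - x \<in> K \<and> inverse x \<in> K)"

definition primitive_element :: "'a::field \<Rightarrow> bool" where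
  "primitive_element \<alpha> \<longleftrightarrow> range (\<lambda>k::nat. \<alpha> ^ k) = UNIV - {0}"

text \<open>The trace from the field with \<open>q ^ n\<close> elements to its subfield with \<open>q\<close> elements,
  as the sum of the Galois conjugates.\<close>

definition field_trace :: "nat \<Rightarrow> nat \<Rightarrow> 'a::field \<Rightarrow> 'a" where
  "field_trace q n x = (\<Sum>i<n. x ^ (q ^ i))"

definition words :: "'a set \<Rightarrow> nat \<Rightarrow> 'a vec set" where
  "words K N = {v \<in> carrier_vec N. set\<^sub>v v \<subseteq> K}"

definition linear_code :: "'a::field set \<Rightarrow> nat \<Rightarrow> 'a vec set \<Rightarrow> bool" where
  "linear_code K N D \<longleftrightarrow> D \<subseteq> words K N \<and> 0\<^sub>v N \<in> D \<and>
     (\<forall>v\<in>D. \<forall>w\<in>D. v + w \<in> D) \<and> (\<forall>c\<in>K. \<forall>v\<in>D. c \<cdot>\<^sub>v v \<in> D)"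

text \<open>The shift moves entries to the left. For a finite set of words, invariance under it is
  the same as invariance under the shift to the right.\<close>

definition cyclic_shift :: "nat \<Rightarrow> 'a vec \<Rightarrow> 'a vec" where
  "cyclic_shift l v = vec (dim_vec v) (\<lambda>k. v $ ((k + l) mod dim_vec v))"

definition shift_invariant :: "nat \<Rightarrow> 'a vec set \<Rightarrow> bool" where
  "shift_invariant l D \<longleftrightarrow> (\<forall>v\<in>D. cyclic_shift l v \<in> D)"

definition quasi_cyclic :: "'a::field set \<Rightarrow> nat \<Rightarrow> nat \<Rightarrow> 'a vec set \<Rightarrow> bool" where
  "quasi_cyclic K N l D \<longleftrightarrow> linear_code K N D \<and> 0 < l \<and> shift_invariant l D \<and>
     (\<forall>l'. 0 < l' \<and> shift_invariant l' D \<longrightarrow> l \<le> l')"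

definition simplex_code :: "nat \<Rightarrow> nat \<Rightarrow> 'a::field \<Rightarrow> 'a vec set" where
  "simplex_code q n \<alpha> =
     {vec (q ^ n - 1) (\<lambda>k. field_trace q n (s * \<alpha> ^ k)) | s. True}"

text \<open>The number of nonzero subspaces of an \<open>m\<close>-dimensional vector space over the field with
  \<open>Q\<close> elements, as a sum of Gaussian binomial coefficients.\<close>

definition num_subspaces :: "nat \<Rightarrow> nat \<Rightarrow> rat" where
  "num_subspaces m Q = (\<Sum>k=1..m.
     (\<Prod>j<k. of_nat Q ^ m - of_nat Q ^ j) / (\<Prod>j<k. of_nat Q ^ k - of_nat Q ^ j))"

text \<open>The primes are \<open>u j\<close> with exponents \<open>a j\<close> for \<open>j\<close> in \<open>{1..t}\<close>, and \<open>J\<close> is a subset of \<open>{1..t}\<close>.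
  The truncated subtraction \<open>a j - i j - 1\<close> is only reached when \<open>i j + 1 \<le> a j\<close> on \<open>J\<close>;
  \<open>a \<mu> - i \<mu>\<close> does not truncate as long as \<open>i \<le> a\<close> pointwise on \<open>{1..t}\<close>.\<close>

definition num_subspaces_over ::
  "nat \<Rightarrow> nat \<Rightarrow> (nat \<Rightarrow> nat) \<Rightarrow> (nat \<Rightarrow> nat) \<Rightarrow> (nat \<Rightarrow> nat) \<Rightarrow> nat set \<Rightarrow> rat" where
  "num_subspaces_over q t u a i J =
     (if \<forall>j\<in>J. i j + 1 \<le> a j
      then num_subspaces
             ((\<Prod>j\<in>J. u j ^ (a j - i j - 1)) * (\<Prod>\<mu>\<in>{1..t} - J. u \<mu> ^ (a \<mu> - i \<mu>)))
             (q ^ ((\<Prod>j\<in>J. u j ^ (i j + 1)) * (\<Prod>\<mu>\<in>{1..t} - J. u \<mu> ^ i \<mu>)))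
      else 0)"

end

theory Submission
  imports Defs "HOL-Number_Theory.Residues" "HOL-Computational_Algebra.Polynomial"
begin

text \<open>
  The trace form is nondegenerate, so the codewords are in \<open>K\<close>-linear bijection with the elements
  of the big field \<open>F\<close>, and the subcodes with the \<open>K\<close>-subspaces \<open>V\<close> of \<open>F\<close>. Shifting by \<open>l\<close>
  becomes multiplication by \<open>\<alpha> ^ l\<close>. The elements \<open>x\<close> with \<open>x V \<subseteq> V\<close> form a subfield containing
  \<open>K\<close>, say of order \<open>q ^ d\<close> with \<open>d\<close> dividing \<open>n\<close>, and it contains \<open>\<alpha> ^ l\<close> iff \<open>l\<close> is a multiple
  of \<open>(q ^ n - 1) / (q ^ d - 1)\<close>, which is therefore the index of the subcode. With
  \<open>e = \<Prod>j. u j ^ i j\<close>, the subcodes of the given index thus are the nonzero subspaces over the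
  field of order \<open>q ^ e\<close> that are not subspaces over the field of order \<open>q ^ (e * u j)\<close> for any
  \<open>j\<close>. Inclusion--exclusion counts them, because being a subspace over all of these fields for
  \<open>j \<in> J\<close> means being one over the field of order \<open>q ^ (e * (\<Prod>j\<in>J. u j))\<close>.
\<close>

section \<open>Counting subspaces over a subfield\<close>

definition is_subspace :: "'a::field set \<Rightarrow> 'a set \<Rightarrow> bool" where
  "is_subspace E V \<longleftrightarrow> 0 \<in> V \<and> (\<forall>x\<in>V. \<forall>y\<in>V. x + y \<in> V) \<and> (\<forall>c\<in>E. \<forall>x\<in>V. c * x \<in> V)"

fun lin_span :: "'a::field set \<Rightarrow> 'a list \<Rightarrow> 'a set" where
  "lin_span E [] = {0}"
| "lin_span E (x # xs) = (\<lambda>(c, w). c * x + w) ` (E \<times> lin_span E xs)"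

text \<open>Each vector is compared only with the span of those after it. Over a field this is
  ordinary linear independence, and it lets independent lists be counted by prepending one vector at
  a time.\<close>

fun lin_indep :: "'a::field set \<Rightarrow> 'a list \<Rightarrow> bool" where
  "lin_indep E [] \<longleftrightarrow> True"
| "lin_indep E (x # xs) \<longleftrightarrow> x \<notin> lin_span E xs \<and> lin_indep E xs"

lemma is_subfield_UNIV: "is_subfield UNIV"
  by (simp add: is_subfield_def)

lemma is_subspace_diff:
  assumes "is_subfield E" "is_subspace E V" "x \<in> V" "y \<in> V"
  shows "x - y \<in> V"
proof -
  have "-1 \<in> E" using assms(1) by (auto simp: is_subfield_def)
  hence "(-1) * y \<in> V" using assms unfolding is_subspace_def by blast
  hence "x + (-1) * y \<in> V" using assms unfolding is_subspace_def by blast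
  thus ?thesis by simp
qed

lemma is_subspace_lin_span:
  assumes "is_subfield E"
  shows "is_subspace E (lin_span E xs)"
proof (induction xs)
  case Nil
  then show ?case by (simp add: is_subspace_def)
next
  case (Cons x xs)
  have E: "0 \<in> E" "\<And>a b. a \<in> E \<Longrightarrow> b \<in> E \<Longrightarrow> a + b \<in> E" "\<And>a b. a \<in> E \<Longrightarrow> b \<in> E \<Longrightarrow> a * b \<in> E"
    using assms by (auto simp: is_subfield_def)
  have W: "0 \<in> lin_span E xs"
    "\<And>a b. a \<in> lin_span E xs \<Longrightarrow> b \<in> lin_span E xs \<Longrightarrow> a + b \<in> lin_span E xs"
    "\<And>a b. a \<in> E \<Longrightarrow> b \<in> lin_span E xs \<Longrightarrow> a * b \<in> lin_span E xs"
    using Cons by (auto simp: is_subspace_def)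
  show ?case
    unfolding is_subspace_def
  proof (intro conjI ballI)
    show "0 \<in> lin_span E (x # xs)"
      using E W by (auto intro!: image_eqI[of _ _ "(0, 0)"])
  next
    fix y z assume "y \<in> lin_span E (x # xs)" "z \<in> lin_span E (x # xs)"
    then obtain c w d v where "c \<in> E" "d \<in> E" "w \<in> lin_span E xs" "v \<in> lin_span E xs"
      "y = c * x + w" "z = d * x + v" by auto
    thus "y + z \<in> lin_span E (x # xs)"
      using E W by (auto intro!: image_eqI[of _ _ "(c + d, w + v)"] simp: algebra_simps)
  next
    fix b y assume b: "b \<in> E" and "y \<in> lin_span E (x # xs)"
    then obtain c w where "c \<in> E" "w \<in> lin_span E xs" "y = c * x + w" by auto
    thus "b * y \<in> lin_span E (x # xs)"
      using b E W by (auto intro!: image_eqI[of _ _ "(b * c, b * w)"] simp: algebra_simps)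
  qed
qed

lemma lin_span_subset:
  assumes "is_subspace E V" "set xs \<subseteq> V"
  shows "lin_span E xs \<subseteq> V"
  using assms(2)
proof (induction xs)
  case Nil
  then show ?case using assms(1) by (simp add: is_subspace_def)
next
  case (Cons x xs)
  then show ?case using assms(1) by (auto simp: is_subspace_def)
qed

lemma set_subset_lin_span:
  assumes "is_subfield E"
  shows "set xs \<subseteq> lin_span E xs"
proof (induction xs)
  case (Cons x xs)
  have 01: "0 \<in> E" "1 \<in> E" using assms by (auto simp: is_subfield_def)
  have "0 \<in> lin_span E xs" using is_subspace_lin_span[OF assms] by (auto simp: is_subspace_def)
  hence "x \<in> lin_span E (x # xs)" using 01 by (auto intro!: image_eqI[of _ _ "(1, 0)"])
  moreover have "lin_span E xs \<subseteq> lin_span E (x # xs)"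
  proof
    fix w assume "w \<in> lin_span E xs"
    thus "w \<in> lin_span E (x # xs)" using 01 by (auto intro!: image_eqI[of _ _ "(0, w)"])
  qed
  ultimately show ?case using Cons by auto
qed simp

text \<open>Prepending an independent vector \<open>x\<close> multiplies the size by
  \<open>card E\<close>: a coincidence \<open>c * x + w = d * x + v\<close> with distinct
  \<open>c\<close>, \<open>d\<close> could be solved for \<open>x\<close>, putting it in the span of
  \<open>xs\<close>.\<close>

lemma card_lin_span:
  fixes E :: "'a::{field, finite} set"
  assumes "is_subfield E" "lin_indep E xs"
  shows "card (lin_span E xs) = card E ^ length xs"
  using assms(2)
proof (induction xs)
  case (Cons x xs)
  let ?W = "lin_span E xs"
  have W: "is_subspace E ?W" by (rule is_subspace_lin_span[OF assms(1)])
  have "inj_on (\<lambda>(c, w). c * x + w) (E \<times> ?W)"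
  proof (rule inj_onI, clarsimp)
    fix c w d v assume *: "c \<in> E" "w \<in> ?W" "d \<in> E" "v \<in> ?W" "c * x + w = d * x + v"
    have eq: "(c - d) * x = v - w" using *(5) by (simp add: algebra_simps)
    have "c = d"
    proof (rule ccontr)
      assume "c \<noteq> d"
      have "c + (- d) \<in> E" using * assms(1) unfolding is_subfield_def by blast
      hence "inverse (c - d) \<in> E" using assms(1) by (auto simp: is_subfield_def)
      moreover have "v - w \<in> ?W" by (rule is_subspace_diff[OF assms(1) W]) (use * in auto)
      ultimately have "inverse (c - d) * (v - w) \<in> ?W" using W by (auto simp: is_subspace_def)
      also have "inverse (c - d) * (v - w) = x" using \<open>c \<noteq> d\<close> by (simp flip: eq)
      finally show False using Cons.prems by simp
    qed
    thus "c = d \<and> w = v" using * by simp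
  qed
  hence "card (lin_span E (x # xs)) = card (E \<times> ?W)" by (simp add: card_image)
  thus ?case using Cons by (simp add: card_cartesian_product)
qed simp

text \<open>An independent list of length \<open>k\<close> is extended by any vector of
  \<open>W\<close> outside its span, which has \<open>card E ^ k\<close> elements. Whenever such a
  list exists its span lies in \<open>W\<close>, so the subtraction used in counting its extensions
  does not truncate.\<close>

lemma card_lin_indep_lists:
  fixes E W :: "'a::{field, finite} set"
  assumes "is_subfield E" "is_subspace E W"
  shows "card {xs. length xs = k \<and> set xs \<subseteq> W \<and> lin_indep E xs} = (\<Prod>j<k. card W - card E ^ j)"
proof (induction k)
  case 0
  have "{xs. length xs = 0 \<and> set xs \<subseteq> W \<and> lin_indep E xs} = {[]}" by auto
  then show ?case by simp
next
  case (Suc k)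
  let ?L = "\<lambda>k. {xs. length xs = k \<and> set xs \<subseteq> W \<and> lin_indep E xs}"
  have fin: "finite (?L k)"
    by (rule finite_subset[OF _ finite_lists_length_eq[of W k]]) auto
  have "?L (Suc k) = (\<lambda>(ys, x). x # ys) ` (SIGMA ys:?L k. W - lin_span E ys)"
    by (auto simp: length_Suc_conv image_iff)
  also have "card \<dots> = card (SIGMA ys:?L k. W - lin_span E ys)"
    by (rule card_image) (auto simp: inj_on_def)
  also have "\<dots> = (\<Sum>ys\<in>?L k. card (W - lin_span E ys))"
    using fin by (simp add: card_SigmaI)
  also have "\<dots> = (\<Sum>ys\<in>?L k. card W - card E ^ k)"
  proof (rule sum.cong[OF refl])
    fix ys assume "ys \<in> ?L k"
    thus "card (W - lin_span E ys) = card W - card E ^ k"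
      using lin_span_subset[OF assms(2), of ys] card_lin_span[OF assms(1), of ys]
      by (simp add: card_Diff_subset)
  qed
  finally show ?case using Suc by simp
qed

lemma card_subfield_ge_2:
  fixes E :: "'a::{field, finite} set"
  assumes "is_subfield E"
  shows "2 \<le> card E"
proof -
  have "{0, 1} \<subseteq> E" using assms by (auto simp: is_subfield_def)
  from card_mono[OF _ this] show ?thesis by simp
qed

text \<open>A longest independent list in \<open>W\<close> spans \<open>W\<close>, for otherwise a
  vector outside its span could be prepended.\<close>

lemma card_subspace:
  fixes E W :: "'a::{field, finite} set"
  assumes E: "is_subfield E" and W: "is_subspace E W"
  obtains k where "card W = card E ^ k"
proof -
  define P where "P k \<longleftrightarrow> (\<exists>xs. length xs = k \<and> set xs \<subseteq> W \<and> lin_indep E xs)" for k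
  \<comment> \<open>This bound guarantees that a greatest length exists; it comes from
    \<open>k < 2 ^ k\<close> and \<open>2 ^ k \<le> card E ^ k\<close>.\<close>
  have "k \<le> card W" if "P k" for k
  proof -
    from that obtain xs where xs: "length xs = k" "set xs \<subseteq> W" "lin_indep E xs"
      by (auto simp: P_def)
    have "card (lin_span E xs) \<le> card W"
      by (rule card_mono[OF _ lin_span_subset[OF W xs(2)]]) simp
    hence "card E ^ k \<le> card W"
      using card_lin_span[OF E xs(3)] xs(1) by simp
    moreover have "k < 2 ^ k" by (rule less_exp)
    moreover have "2 ^ k \<le> card E ^ k"
      using card_subfield_ge_2[OF E] by (simp add: power_mono)
    ultimately show ?thesis by linarith
  qed
  moreover have "P 0" by (auto simp: P_def)
  ultimately obtain k where k: "P k" "\<And>l. P l \<Longrightarrow> l \<le> k"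
    using Greatest_le_nat[of P] GreatestI_nat[of P] by metis
  from k(1) obtain xs where xs: "length xs = k" "set xs \<subseteq> W" "lin_indep E xs"
    by (auto simp: P_def)
  have "W \<subseteq> lin_span E xs"
  proof
    fix x assume "x \<in> W"
    show "x \<in> lin_span E xs"
    proof (rule ccontr)
      assume "x \<notin> lin_span E xs"
      hence "P (Suc k)" unfolding P_def using xs \<open>x \<in> W\<close> by (intro exI[of _ "x # xs"]) auto
      from k(2)[OF this] show False by simp
    qed
  qed
  hence "W = lin_span E xs" using lin_span_subset[OF W xs(2)] by auto
  thus ?thesis using card_lin_span[OF E xs(3)] that by simp
qed

text \<open>Once the sizes match, inclusion of the span in \<open>U\<close> is already equality.
  Hence an independent list of length \<open>k\<close> lies in only one \<open>k\<close>-dimensional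
  subspace, which makes the double count disjoint.\<close>

lemma lin_span_eq_iff:
  fixes E U :: "'a::{field, finite} set"
  assumes E: "is_subfield E" and U: "is_subspace E U" "card U = card E ^ length xs"
    and xs: "lin_indep E xs"
  shows "set xs \<subseteq> U \<longleftrightarrow> lin_span E xs = U"
proof
  assume "set xs \<subseteq> U"
  from lin_span_subset[OF U(1) this] show "lin_span E xs = U"
    using U(2) card_lin_span[OF E xs] by (intro card_subset_eq) auto
next
  assume "lin_span E xs = U"
  thus "set xs \<subseteq> U" using set_subset_lin_span[OF E] by blast
qed

lemma of_nat_prod_diff_power:
  fixes Q :: nat
  assumes "k \<le> m" "1 \<le> Q"
  shows "(of_nat (\<Prod>j<k. Q ^ m - Q ^ j) :: rat) = (\<Prod>j<k. of_nat Q ^ m - of_nat Q ^ j)"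
  unfolding of_nat_prod
  by (rule prod.cong) (use assms in \<open>auto simp: of_nat_diff power_increasing\<close>)

text \<open>Double counting of the independent lists of length \<open>k\<close>: each spans exactly one
  \<open>k\<close>-dimensional subspace.\<close>

lemma card_subspaces_of_card:
  fixes E :: "'a::{field, finite} set"
  assumes E: "is_subfield E" and m: "card (UNIV :: 'a set) = card E ^ m" and k: "k \<le> m"
  shows "(of_nat (card {U. is_subspace E U \<and> card U = card E ^ k}) :: rat) =
    (\<Prod>j<k. of_nat (card E) ^ m - of_nat (card E) ^ j) /
    (\<Prod>j<k. of_nat (card E) ^ k - of_nat (card E) ^ j)"
proof -
  let ?Q = "card E"
  let ?S = "{U. is_subspace E U \<and> card U = ?Q ^ k}"
  let ?L = "\<lambda>U. {xs. length xs = k \<and> set xs \<subseteq> U \<and> lin_indep E xs}"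
  have fin: "finite (?L U)" for U
    by (rule finite_subset[OF _ finite_lists_length_eq[of UNIV k]]) auto
  have Q: "2 \<le> ?Q" by (rule card_subfield_ge_2[OF E])
  have "?L UNIV = (\<Union>U\<in>?S. ?L U)"
  proof (intro equalityI subsetI)
    fix xs assume "xs \<in> ?L UNIV"
    thus "xs \<in> (\<Union>U\<in>?S. ?L U)"
      using is_subspace_lin_span[OF E, of xs] card_lin_span[OF E, of xs]
        set_subset_lin_span[OF E, of xs] by blast
  qed auto
  also have "card \<dots> = (\<Sum>U\<in>?S. card (?L U))"
  proof (rule card_UN_disjoint)
    show "\<forall>i\<in>?S. \<forall>j\<in>?S. i \<noteq> j \<longrightarrow> ?L i \<inter> ?L j = {}"
      using lin_span_eq_iff[OF E] by blast
  qed (use fin in auto)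
  also have "\<dots> = (\<Sum>U\<in>?S. \<Prod>j<k. ?Q ^ k - ?Q ^ j)"
    by (rule sum.cong) (simp_all add: card_lin_indep_lists[OF E])
  finally have "(\<Prod>j<k. ?Q ^ m - ?Q ^ j) = card ?S * (\<Prod>j<k. ?Q ^ k - ?Q ^ j)"
    using card_lin_indep_lists[OF E, of UNIV k] m by (simp add: is_subspace_def)
  hence "(of_nat (\<Prod>j<k. ?Q ^ m - ?Q ^ j) :: rat) =
      of_nat (card ?S) * of_nat (\<Prod>j<k. ?Q ^ k - ?Q ^ j)"
    by (simp only: of_nat_mult)
  hence *: "(\<Prod>j<k. of_nat ?Q ^ m - of_nat ?Q ^ j) =
      (of_nat (card ?S) :: rat) * (\<Prod>j<k. of_nat ?Q ^ k - of_nat ?Q ^ j)"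
    using Q k by (simp only: of_nat_prod_diff_power)
  have "(of_nat ?Q ^ k - of_nat ?Q ^ j :: rat) \<noteq> 0" if "j < k" for j
  proof -
    have "(of_nat ?Q ^ j :: rat) < of_nat ?Q ^ k"
      using Q that by (intro power_strict_increasing) auto
    thus ?thesis by simp
  qed
  hence "(\<Prod>j<k. of_nat ?Q ^ k - of_nat ?Q ^ j :: rat) \<noteq> 0" by simp
  thus ?thesis unfolding * by simp
qed

text \<open>Subspaces are sorted by dimension \<open>k\<close>. Their order is
  \<open>card E ^ k\<close>, so different \<open>k\<close> give disjoint classes, and
  \<open>k = 0\<close> is exactly the excluded zero space.\<close>

lemma card_nonzero_subspaces:
  fixes E :: "'a::{field, finite} set"
  assumes E: "is_subfield E" and m: "card (UNIV :: 'a set) = card E ^ m"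
  shows "of_nat (card {V. is_subspace E V \<and> V \<noteq> {0}}) = num_subspaces m (card E)"
proof -
  let ?Q = "card E"
  have Q: "2 \<le> ?Q" by (rule card_subfield_ge_2[OF E])
  have "{V. is_subspace E V \<and> V \<noteq> {0}} = (\<Union>k\<in>{1..m}. {U. is_subspace E U \<and> card U = ?Q ^ k})"
  proof (intro equalityI subsetI)
    fix V assume "V \<in> {V. is_subspace E V \<and> V \<noteq> {0}}"
    hence V: "is_subspace E V" "V \<noteq> {0}" by auto
    obtain k where k: "card V = ?Q ^ k" using card_subspace[OF E V(1)] .
    have "k \<noteq> 0"
    proof
      assume "k = 0"
      then obtain x where "V = {x}" using k by (auto simp: card_1_singleton_iff)
      thus False using V by (auto simp: is_subspace_def)
    qed
    moreover have "?Q ^ k \<le> ?Q ^ m" using k m card_mono[of UNIV V] by simp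
    hence "k \<le> m" using Q by (metis power_le_imp_le_exp Suc_1 Suc_le_lessD)
    ultimately show "V \<in> (\<Union>k\<in>{1..m}. {U. is_subspace E U \<and> card U = ?Q ^ k})"
      using V k by auto
  next
    fix V assume "V \<in> (\<Union>k\<in>{1..m}. {U. is_subspace E U \<and> card U = ?Q ^ k})"
    then obtain k where k: "1 \<le> k" "is_subspace E V" "card V = ?Q ^ k" by auto
    have "card V \<noteq> 1" using k Q by simp
    hence "V \<noteq> {0}" by auto
    thus "V \<in> {V. is_subspace E V \<and> V \<noteq> {0}}" using k by auto
  qed
  also have "card \<dots> = (\<Sum>k\<in>{1..m}. card {U. is_subspace E U \<and> card U = ?Q ^ k})"
  proof (rule card_UN_disjoint)
    show "\<forall>k\<in>{1..m}. \<forall>l\<in>{1..m}. k \<noteq> l \<longrightarrow>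
        {U. is_subspace E U \<and> card U = ?Q ^ k} \<inter> {U. is_subspace E U \<and> card U = ?Q ^ l} = {}"
      using Q by auto
  qed simp_all
  finally show ?thesis
    unfolding num_subspaces_def of_nat_sum
    by (simp add: card_subspaces_of_card[OF E m])
qed

section \<open>Subfields of a finite field\<close>

declare One_nat_def [simp del]

text \<open>Multiplication by a nonzero \<open>x\<close> in \<open>E\<close> permutes the nonzero
  elements of \<open>E\<close>; comparing the product of all of them before and after gives the
  claim.\<close>

lemma subfield_power_card:
  fixes E :: "'a::{field, finite} set"
  assumes E: "is_subfield E" and x: "x \<in> E"
  shows "x ^ card E = x"
proof (cases "x = 0")
  case True
  then show ?thesis using card_subfield_ge_2[OF E] by (auto simp: power_0_left simp del: card_eq_0_iff)
next
  case False
  have "bij_betw ((*) x) (E - {0}) (E - {0})"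
  proof (rule bij_betw_byWitness[where f' = "(*) (inverse x)"])
    have "x * y \<in> E" "inverse x * y \<in> E" if "y \<in> E" for y
      using E x that by (auto simp: is_subfield_def)
    thus "(*) x ` (E - {0}) \<subseteq> E - {0}" "(*) (inverse x) ` (E - {0}) \<subseteq> E - {0}"
      using False by auto
  qed (use False in auto)
  hence "(\<Prod>y\<in>E - {0}. x * y) = (\<Prod>y\<in>E - {0}. y)"
    by (rule prod.reindex_bij_betw)
  hence "x ^ card (E - {0}) * \<Prod>(E - {0}) = \<Prod>(E - {0})"
    by (simp add: prod.distrib)
  hence "x ^ card (E - {0}) = 1" by simp
  moreover have "card E = Suc (card (E - {0}))"
    using E by (intro card.remove) (auto simp: is_subfield_def)
  ultimately show ?thesis by simp
qed

text \<open>The fixed points are roots of X^Q - X, which is nonzero because Q is at least 2.\<close>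

lemma card_power_fixed_le:
  fixes Q :: nat
  assumes "2 \<le> Q"
  shows "card {x :: 'a::{field, finite}. x ^ Q = x} \<le> Q"
proof -
  let ?p = "Polynomial.monom (1::'a) Q - Polynomial.monom 1 1"
  have 1: "Polynomial.degree ?p \<le> Q"
    using assms by (intro order_trans[OF degree_diff_le_max]) (auto simp: degree_monom_eq)
  have "Polynomial.coeff ?p Q = 1" using assms by simp
  hence "?p \<noteq> 0" by (metis coeff_0 zero_neq_one)
  from card_poly_roots_bound[OF this] 1 show ?thesis
    by (simp add: poly_monom)
qed

section \<open>The field extension and the fixed fields of powers of Frobenius\<close>

locale finite_field_extension =
  fixes q n :: nat and K :: "'a::{field, finite} set" and \<alpha> :: 'a
  assumes primepow_q: "primepow q" and n_pos: "0 < n"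
    and card_UNIV: "card (UNIV :: 'a set) = q ^ n"
    and subfield_K: "is_subfield K" and card_K: "card K = q"
    and primitive: "primitive_element \<alpha>"
begin

text \<open>For \<open>d\<close> dividing \<open>n\<close> this is the unique subfield of order
  \<open>q ^ d\<close>. The equation makes sense for every \<open>d\<close>, with closure under the
  field operations following from additivity of Frobenius.\<close>

definition fixed_field :: "nat \<Rightarrow> 'a set" where
  "fixed_field d = {x. x ^ (q ^ d) = x}"

text \<open>Only inclusion of \<open>x V\<close> in \<open>V\<close> is required, so that 0 belongs
  to it and a field can result; for nonzero \<open>x\<close> and finite \<open>V\<close> inclusion
  is equality.\<close>

definition stabilizer :: "'a set \<Rightarrow> 'a set" where
  "stabilizer V = {x. \<forall>v\<in>V. x * v \<in> V}"

definition codeword :: "'a \<Rightarrow> 'a vec" where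
  "codeword s = vec (q ^ n - 1) (\<lambda>k. field_trace q n (s * \<alpha> ^ k))"

lemma q_ge_2: "2 \<le> q"
  using card_subfield_ge_2[OF subfield_K] card_K by simp

lemma q_power_ge_2: "0 < d \<Longrightarrow> 2 \<le> q ^ d"
  using q_ge_2 self_le_power[of q d] by linarith

text \<open>The characteristic divides the order \<open>q ^ n\<close> of the field, so it is the
  prime underlying \<open>q\<close>. This is what makes the maps x -> x^(q^d) additive.\<close>

lemma q_power_CHAR:
  obtains k where "q ^ d = CHAR('a) ^ k" "prime CHAR('a)"
proof -
  have p: "prime CHAR('a)"
    by (rule prime_CHAR_semidom) (simp add: finite_imp_CHAR_pos)
  obtain p k where pk: "prime p" "q = p ^ k"
    using primepow_q by (auto simp: primepow_def)
  have "CHAR('a) dvd q ^ n" using CHAR_dvd_CARD[where 'a = 'a] card_UNIV by simp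
  hence "CHAR('a) dvd p" using p pk by (metis prime_dvd_power)
  hence "CHAR('a) = p" using p pk primes_dvd_imp_eq by blast
  thus ?thesis using that[of "k * d"] pk p by (simp add: power_mult)
qed

lemma frobenius_add: "(x + y :: 'a) ^ (q ^ d) = x ^ (q ^ d) + y ^ (q ^ d)"
  using q_power_CHAR[of d] freshmans_dream' by metis

lemma frobenius_sum: "(sum f A :: 'a) ^ (q ^ d) = (\<Sum>x\<in>A. f x ^ (q ^ d))"
  using q_power_CHAR[of d] freshmans_dream_sum' by metis

lemma power_q_n: "(x :: 'a) ^ (q ^ n) = x"
  using subfield_power_card[OF is_subfield_UNIV, of x] card_UNIV by simp

lemma subfield_fixed_field: "is_subfield (fixed_field d)"
proof -
  \<comment> \<open>Applying additivity to \<open>x + - x\<close> avoids a case distinction on the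
    parity of \<open>q\<close>.\<close>
  have neg: "(- x) ^ (q ^ d) = - x" if "x ^ (q ^ d) = x" for x :: 'a
  proof -
    have "(x + - x) ^ (q ^ d) = x + (- x) ^ (q ^ d)"
      unfolding frobenius_add that ..
    moreover have "(0::'a) ^ (q ^ d) = 0" using q_ge_2 by (simp add: power_0_left)
    ultimately have "x + (- x) ^ (q ^ d) = 0" by simp
    thus ?thesis by (simp add: add_eq_0_iff)
  qed
  show ?thesis
    unfolding is_subfield_def fixed_field_def
    using q_ge_2 neg by (auto simp: power_0_left frobenius_add power_mult_distrib power_inverse)
qed

lemma card_fixed_field_le: "0 < d \<Longrightarrow> card (fixed_field d) \<le> q ^ d"
  unfolding fixed_field_def using card_power_fixed_le[of "q ^ d"] q_power_ge_2 by auto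

text \<open>Every element of \<open>E\<close> is fixed, and the fixed field has at most
  \<open>q ^ d\<close> elements, so a subfield is determined by its order.\<close>

lemma subfield_eq_fixed_field:
  assumes "is_subfield E" "card E = q ^ d" "0 < d"
  shows "E = fixed_field d"
proof (rule card_seteq)
  show "E \<subseteq> fixed_field d"
    using subfield_power_card[OF assms(1)] assms(2) by (auto simp: fixed_field_def)
qed (use card_fixed_field_le assms in auto)

lemma K_eq: "K = fixed_field 1"
  using subfield_eq_fixed_field[OF subfield_K, of 1] card_K by simp

lemma fixed_field_mono:
  assumes "d dvd e"
  shows "fixed_field d \<subseteq> fixed_field e"
proof -
  obtain k where e: "e = d * k" using assms by auto
  have "x ^ (q ^ (d * k)) = x" if "x ^ (q ^ d) = x" for x :: 'a
  proof (induction k)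
    case (Suc k)
    have "x ^ (q ^ (d * Suc k)) = (x ^ (q ^ (d * k))) ^ (q ^ d)"
      by (simp only: mult_Suc_right power_add mult.commute flip: power_mult)
    thus ?case using Suc that by simp
  qed simp
  thus ?thesis by (auto simp: e fixed_field_def)
qed

section \<open>Powers of the primitive element and the lattice of subfields\<close>

lemma alpha_nonzero: "\<alpha> \<noteq> 0"
proof
  assume "\<alpha> = 0"
  have "\<alpha> ^ 1 \<in> UNIV - {0}" using primitive unfolding primitive_element_def by blast
  thus False using \<open>\<alpha> = 0\<close> by simp
qed

lemma alpha_power_N: "\<alpha> ^ (q ^ n - 1) = 1"
proof -
  have "\<alpha> ^ (q ^ n - 1) * \<alpha> = \<alpha>"
    using power_minus_mult[of "q ^ n" \<alpha>] power_q_n[of \<alpha>] q_ge_2 by simp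
  thus ?thesis using alpha_nonzero by simp
qed

lemma alpha_power_mod: "\<alpha> ^ (k mod (q ^ n - 1)) = \<alpha> ^ k"
proof -
  have "\<alpha> ^ k = \<alpha> ^ ((q ^ n - 1) * (k div (q ^ n - 1)) + k mod (q ^ n - 1))" by simp
  also have "\<dots> = \<alpha> ^ (k mod (q ^ n - 1))"
    unfolding power_add power_mult alpha_power_N by simp
  finally show ?thesis ..
qed

text \<open>Reducing exponents modulo \<open>q ^ n - 1\<close> keeps the powers exhaustive; since
  both sets have \<open>q ^ n - 1\<close> elements, surjectivity forces injectivity.\<close>

lemma bij_alpha_power: "bij_betw (\<lambda>k. \<alpha> ^ k) {..<q ^ n - 1} (UNIV - {0})"
proof -
  have N: "0 < q ^ n - 1" using q_power_ge_2[OF n_pos] by linarith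
  have "(\<lambda>k. \<alpha> ^ k) ` {..<q ^ n - 1} = UNIV - {0}"
  proof (intro equalityI subsetI)
    fix x :: 'a assume "x \<in> UNIV - {0}"
    then obtain k where "x = \<alpha> ^ k" using primitive unfolding primitive_element_def by blast
    hence "x = \<alpha> ^ (k mod (q ^ n - 1))" by (simp add: alpha_power_mod)
    thus "x \<in> (\<lambda>k. \<alpha> ^ k) ` {..<q ^ n - 1}" using N by simp
  qed (use alpha_nonzero in auto)
  moreover from this have "inj_on (\<lambda>k. \<alpha> ^ k) {..<q ^ n - 1}"
    by (intro eq_card_imp_inj_on) (simp_all add: card_UNIV card_Diff_subset)
  ultimately show ?thesis by (simp add: bij_betw_def)
qed

lemma alpha_power_eq_1_iff: "\<alpha> ^ k = 1 \<longleftrightarrow> (q ^ n - 1) dvd k"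
proof
  assume "\<alpha> ^ k = 1"
  hence "\<alpha> ^ (k mod (q ^ n - 1)) = \<alpha> ^ 0" by (simp add: alpha_power_mod)
  moreover have "0 < q ^ n - 1" using q_power_ge_2[OF n_pos] by linarith
  ultimately have "k mod (q ^ n - 1) = 0"
    using bij_alpha_power unfolding bij_betw_def
    by (metis (mono_tags, lifting) inj_onD lessThan_iff mod_less_divisor)
  thus "(q ^ n - 1) dvd k" by auto
next
  assume "(q ^ n - 1) dvd k"
  thus "\<alpha> ^ k = 1" by (auto simp: power_mult alpha_power_N)
qed

lemma power_minus_1_dvd:
  assumes "d dvd n"
  shows "(q ^ d - 1) dvd (q ^ n - 1)"
proof -
  obtain k where n: "n = d * k" using assms by auto
  have "[q ^ d = 1] (mod (q ^ d - 1))"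
    using q_ge_2 by (simp add: cong_altdef_nat)
  from cong_pow[OF this, of k] have "[q ^ n = 1] (mod (q ^ d - 1))"
    by (simp add: n power_mult)
  thus ?thesis using q_ge_2 by (simp add: cong_altdef_nat)
qed

text \<open>Being fixed means that \<alpha>^(l(q^d - 1)) = 1, that is, q^n - 1 divides l(q^d - 1);
  the factor q^d - 1 then cancels.\<close>

lemma alpha_power_in_fixed_field_iff:
  assumes "d dvd n"
  shows "\<alpha> ^ l \<in> fixed_field d \<longleftrightarrow> (q ^ n - 1) div (q ^ d - 1) dvd l"
proof -
  have d: "0 < d" using assms n_pos by (auto intro: Nat.gr0I)
  have d1: "0 < q ^ d - 1" using q_power_ge_2[OF d] by linarith
  define L where "L = (q ^ n - 1) div (q ^ d - 1)"
  have N: "q ^ n - 1 = L * (q ^ d - 1)"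
    using power_minus_1_dvd[OF assms] by (simp add: L_def)
  have "(\<alpha> ^ l) ^ (q ^ d) = \<alpha> ^ l * (\<alpha> ^ l) ^ (q ^ d - 1)"
    using power_minus_mult[of "q ^ d" "\<alpha> ^ l"] q_ge_2 by (simp add: mult.commute)
  hence "\<alpha> ^ l \<in> fixed_field d \<longleftrightarrow> (\<alpha> ^ l) ^ (q ^ d - 1) = 1"
    using alpha_nonzero by (simp add: fixed_field_def)
  also have "\<dots> \<longleftrightarrow> L * (q ^ d - 1) dvd l * (q ^ d - 1)"
    by (simp add: alpha_power_eq_1_iff N flip: power_mult)
  also have "\<dots> \<longleftrightarrow> L dvd l" using d1 by simp
  finally show ?thesis by (simp add: L_def)
qed

text \<open>The upper bound is the root count. For the lower bound, 0 and the distinct powers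
  \<alpha>^(Lj) with j < q^d - 1 all lie in the fixed field.\<close>

lemma card_fixed_field:
  assumes "d dvd n"
  shows "card (fixed_field d) = q ^ d"
proof (rule antisym)
  have d: "0 < d" using assms n_pos by (auto intro: Nat.gr0I)
  show "card (fixed_field d) \<le> q ^ d" by (rule card_fixed_field_le[OF d])
  define L where "L = (q ^ n - 1) div (q ^ d - 1)"
  have N: "q ^ n - 1 = L * (q ^ d - 1)"
    using power_minus_1_dvd[OF assms] by (simp add: L_def)
  have L: "0 < L" using N q_power_ge_2[OF n_pos] by (intro Nat.gr0I) auto
  have inj: "inj_on (\<lambda>j. \<alpha> ^ (L * j)) {..<q ^ d - 1}"
  proof (rule inj_onI)
    fix j k assume *: "j \<in> {..<q ^ d - 1}" "k \<in> {..<q ^ d - 1}" "\<alpha> ^ (L * j) = \<alpha> ^ (L * k)"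
    hence "L * j < q ^ n - 1" "L * k < q ^ n - 1" using L by (auto simp: N)
    hence "L * j = L * k"
      using inj_onD[OF bij_betw_imp_inj_on[OF bij_alpha_power] *(3)] by simp
    thus "j = k" using L by simp
  qed
  have "q ^ d = card (insert 0 ((\<lambda>j. \<alpha> ^ (L * j)) ` {..<q ^ d - 1}))"
    using alpha_nonzero q_power_ge_2[OF d] by (subst card_insert_disjoint) (auto simp: card_image[OF inj])
  also have "\<dots> \<le> card (fixed_field d)"
    using alpha_power_in_fixed_field_iff[OF assms] subfield_fixed_field
    by (intro card_mono) (auto simp: is_subfield_def L_def)
  finally show "q ^ d \<le> card (fixed_field d)" .
qed

lemma subfield_degree_dvd:
  assumes "d dvd n" "is_subspace (fixed_field d) (fixed_field e)" "e dvd n"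
  shows "d dvd e"
proof -
  obtain k where "q ^ e = (q ^ d) ^ k"
    using card_subspace[OF subfield_fixed_field assms(2)] assms by (auto simp: card_fixed_field)
  hence "q ^ e = q ^ (d * k)" by (simp add: power_mult)
  hence "e = d * k" using q_ge_2 by (simp add: power_inject_exp)
  thus ?thesis by simp
qed

lemma fixed_field_subset_iff:
  assumes "d dvd n" "e dvd n"
  shows "fixed_field d \<subseteq> fixed_field e \<longleftrightarrow> d dvd e"
proof
  assume "fixed_field d \<subseteq> fixed_field e"
  hence "is_subspace (fixed_field d) (fixed_field e)"
    using subfield_fixed_field[of e] by (auto simp: is_subfield_def is_subspace_def)
  thus "d dvd e" using subfield_degree_dvd assms by blast
qed (rule fixed_field_mono)

text \<open>Two cardinality arguments: \<open>E\<close> is a space over \<open>K\<close>, so its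
  order is some \<open>q ^ d\<close>, and the whole field is a space over \<open>E\<close>, so
  \<open>q ^ n\<close> is a power of \<open>q ^ d\<close>.\<close>

lemma subfield_containing_K:
  assumes E: "is_subfield E" and "K \<subseteq> E"
  obtains d where "d dvd n" "E = fixed_field d"
proof -
  have "is_subspace K E" using assms by (auto simp: is_subfield_def is_subspace_def)
  then obtain d where d: "card E = q ^ d"
    using card_subspace[OF subfield_K] card_K by metis
  have "d \<noteq> 0" using d card_subfield_ge_2[OF E] by (intro notI) simp
  have "is_subspace E UNIV" by (simp add: is_subspace_def)
  then obtain m where "q ^ n = (q ^ d) ^ m"
    using card_subspace[OF E] card_UNIV d by metis
  hence "q ^ n = q ^ (d * m)" by (simp add: power_mult)
  hence "n = d * m" using q_ge_2 by (simp add: power_inject_exp)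
  thus ?thesis using that[of d] subfield_eq_fixed_field[OF E d] \<open>d \<noteq> 0\<close> by simp
qed

section \<open>The field of multipliers of a subspace\<close>

lemma is_subfield_stabilizer:
  assumes V: "is_subspace K V" and "V \<noteq> {0}"
  shows "is_subfield (stabilizer V)"
proof -
  have V0: "0 \<in> V" "\<And>x y. x \<in> V \<Longrightarrow> y \<in> V \<Longrightarrow> x + y \<in> V"
    using V by (auto simp: is_subspace_def)
  have neg: "- x \<in> V" if "x \<in> V" for x
    using is_subspace_diff[OF subfield_K V V0(1) that] by simp
  have inv: "inverse x * v \<in> V" if x: "\<forall>v\<in>V. x * v \<in> V" and v: "v \<in> V" for x v
  proof (cases "x = 0")
    case False
    \<comment> \<open>Multiplication by a nonzero \<open>x\<close> is injective, so on the finite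
      set \<open>V\<close> it is also onto; this yields closure under inverses.\<close>
    have "(*) x ` V = V"
      by (rule card_subset_eq) (use x False in \<open>auto simp: card_image inj_on_def\<close>)
    then obtain w where "w \<in> V" "v = x * w" using v by blast
    thus ?thesis using False by (simp add: field_simps)
  qed (use V0 in simp)
  show ?thesis
    unfolding is_subfield_def stabilizer_def
    using V0 neg inv by (auto simp: algebra_simps)
qed

lemma K_subset_stabilizer: "is_subspace K V \<Longrightarrow> K \<subseteq> stabilizer V"
  by (auto simp: is_subspace_def stabilizer_def)

lemma stabilizer_eq_fixed_field:
  assumes "is_subspace K V" "V \<noteq> {0}"
  obtains d where "d dvd n" "stabilizer V = fixed_field d"
  using subfield_containing_K[OF is_subfield_stabilizer[OF assms] K_subset_stabilizer[OF assms(1)]]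
  by metis

text \<open>This turns a question about scalars into an inclusion between subfields, hence into
  divisibility of degrees.\<close>

lemma is_subspace_fixed_field_iff:
  "is_subspace (fixed_field d) V \<longleftrightarrow> is_subspace K V \<and> fixed_field d \<subseteq> stabilizer V"
proof -
  have "K \<subseteq> fixed_field d" using K_eq fixed_field_mono[of 1 d] by simp
  thus ?thesis by (auto simp: is_subspace_def stabilizer_def)
qed

section \<open>Subcodes of the simplex code\<close>

lemma trace_add: "field_trace q n (x + y :: 'a) = field_trace q n x + field_trace q n y"
  by (simp add: field_trace_def frobenius_add sum.distrib)

lemma trace_0: "field_trace q n (0 :: 'a) = 0"
  using q_ge_2 by (simp add: field_trace_def power_0_left)

lemma trace_mult:
  assumes "c \<in> K"
  shows "field_trace q n (c * x) = c * field_trace q n x"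
proof -
  have "c ^ (q ^ i) = c" for i
    using assms K_eq fixed_field_mono[of 1 i] by (auto simp: fixed_field_def)
  thus ?thesis by (simp add: field_trace_def power_mult_distrib sum_distrib_left)
qed

lemma trace_in_K: "field_trace q n (x :: 'a) \<in> K"
proof -
  have "(field_trace q n x) ^ (q ^ 1) = (\<Sum>i<n. x ^ (q ^ Suc i))"
    unfolding field_trace_def frobenius_sum by (simp add: power_mult mult.commute flip: power_mult)
  also have "\<dots> = (\<Sum>i<n. x ^ (q ^ i))"
    using sum.lessThan_Suc_shift[of "\<lambda>i. x ^ (q ^ i)" n]
      sum.lessThan_Suc[of "\<lambda>i. x ^ (q ^ i)" n] power_q_n[of x] by simp
  finally show ?thesis by (simp add: K_eq fixed_field_def field_trace_def)
qed

text \<open>As a polynomial the trace has degree at most q^(n-1) and leading coefficient 1, so it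
  cannot vanish at all q^n elements.\<close>

lemma trace_nonzero: "\<exists>x :: 'a. field_trace q n x \<noteq> 0"
proof (rule ccontr)
  assume *: "\<not> ?thesis"
  let ?p = "\<Sum>i<n. Polynomial.monom (1::'a) (q ^ i)"
  have "Polynomial.coeff ?p (q ^ (n - 1)) = (\<Sum>i<n. if i = n - 1 then 1 else 0)"
    unfolding coeff_sum using q_ge_2 by (intro sum.cong) (auto simp: power_inject_exp)
  hence "Polynomial.coeff ?p (q ^ (n - 1)) = 1" using n_pos by simp
  hence nz: "?p \<noteq> 0" by auto
  have "Polynomial.degree ?p \<le> q ^ (n - 1)"
  proof (rule degree_sum_le)
    fix i assume "i \<in> {..<n}"
    thus "Polynomial.degree (Polynomial.monom (1::'a) (q ^ i)) \<le> q ^ (n - 1)"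
      using q_ge_2 by (auto simp: degree_monom_eq intro!: power_increasing)
  qed simp
  moreover have "{x. poly ?p x = 0} = UNIV"
    using * by (auto simp: poly_sum poly_monom field_trace_def)
  ultimately have "q ^ n \<le> q ^ (n - 1)"
    using card_poly_roots_bound[OF nz] card_UNIV by simp
  moreover have "q ^ (n - 1) < q ^ n" using q_ge_2 n_pos by (intro power_strict_increasing) auto
  ultimately show False by simp
qed

lemma codeword_add: "codeword (s + r) = codeword s + codeword r"
  by (auto simp: codeword_def trace_add algebra_simps)

lemma codeword_smult: "c \<in> K \<Longrightarrow> codeword (c * s) = c \<cdot>\<^sub>v codeword s"
  by (auto simp: codeword_def mult.assoc trace_mult)

lemma codeword_zero: "codeword 0 = 0\<^sub>v (q ^ n - 1)"
  by (auto simp: codeword_def trace_0)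

text \<open>If two codewords agree, the trace vanishes at every (s - r)\<alpha>^k. For distinct
  \<open>s\<close> and \<open>r\<close> these are all the nonzero elements, contradicting
  \<open>trace_nonzero\<close>.\<close>

lemma inj_codeword: "inj codeword"
proof (rule injI)
  fix s r assume eq: "codeword s = codeword r"
  show "s = r"
  proof (rule ccontr)
    assume "s \<noteq> r"
    have "field_trace q n x = 0" for x :: 'a
    proof (cases "x = 0")
      case True
      then show ?thesis by (simp add: trace_0)
    next
      case False
      hence "x / (s - r) \<in> UNIV - {0}" using \<open>s \<noteq> r\<close> by simp
      hence "x / (s - r) \<in> (\<lambda>k. \<alpha> ^ k) ` {..<q ^ n - 1}"
        unfolding bij_betw_imp_surj_on[OF bij_alpha_power] .
      then obtain k where k: "k < q ^ n - 1" "x / (s - r) = \<alpha> ^ k" by blast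
      have "codeword s $ k = codeword r $ k" by (simp add: eq)
      hence "field_trace q n (s * \<alpha> ^ k) = field_trace q n (r * \<alpha> ^ k)"
        using k by (simp add: codeword_def)
      moreover have "s * \<alpha> ^ k = x + r * \<alpha> ^ k"
        using \<open>s \<noteq> r\<close> by (simp flip: k(2)) (simp add: field_simps)
      ultimately show ?thesis by (simp add: trace_add)
    qed
    thus False using trace_nonzero by blast
  qed
qed

text \<open>The wrap-around of positions is harmless because the exponents of \<alpha> matter only
  modulo the length \<open>q ^ n - 1\<close>.\<close>

lemma codeword_shift: "cyclic_shift l (codeword s) = codeword (s * \<alpha> ^ l)"
proof (rule eq_vecI)
  fix k assume "k < dim_vec (codeword (s * \<alpha> ^ l))"
  hence k: "k < q ^ n - 1" by (simp add: codeword_def)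
  hence "(k + l) mod (q ^ n - 1) < q ^ n - 1" by (intro mod_less_divisor) auto
  thus "cyclic_shift l (codeword s) $ k = codeword (s * \<alpha> ^ l) $ k"
    using k by (simp add: codeword_def cyclic_shift_def alpha_power_mod power_add mult_ac)
qed (simp add: codeword_def cyclic_shift_def)

lemma simplex_code_eq: "simplex_code q n \<alpha> = range codeword"
  by (auto simp: simplex_code_def codeword_def)

lemma codeword_in_image_iff: "codeword s \<in> codeword ` V \<longleftrightarrow> s \<in> V"
  using inj_codeword by (auto dest: injD)

lemma linear_code_image_iff:
  "linear_code K (q ^ n - 1) (codeword ` V) \<longleftrightarrow> is_subspace K V"
proof -
  have "codeword ` V \<subseteq> words K (q ^ n - 1)"
    using trace_in_K by (auto simp: words_def codeword_def vec_set_def)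
  thus ?thesis
    unfolding linear_code_def is_subspace_def
    by (auto simp: codeword_in_image_iff simp flip: codeword_zero codeword_add codeword_smult)
qed

lemma shift_invariant_image_iff:
  "shift_invariant l (codeword ` V) \<longleftrightarrow> \<alpha> ^ l \<in> stabilizer V"
  by (auto simp: shift_invariant_def codeword_shift codeword_in_image_iff stabilizer_def mult.commute)

section \<open>The index of a subcode and its stabilizer\<close>

lemma inj_on_shift_index:
  assumes "d dvd n" "e dvd n" "(q ^ n - 1) div (q ^ d - 1) = (q ^ n - 1) div (q ^ e - 1)"
  shows "d = e"
proof -
  have *: "0 < d" "0 < e" using assms n_pos by (auto intro: Nat.gr0I)
  define L where "L = (q ^ n - 1) div (q ^ d - 1)"
  have "q ^ n - 1 = L * (q ^ d - 1)"
    using power_minus_1_dvd[OF assms(1)] by (simp add: L_def)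
  moreover have "q ^ n - 1 = L * (q ^ e - 1)"
    using power_minus_1_dvd[OF assms(2)] by (simp add: L_def assms(3))
  moreover have "0 < q ^ n - 1" using q_power_ge_2[OF n_pos] by linarith
  ultimately have "q ^ d - 1 = q ^ e - 1" by (metis mult_cancel1 mult_0 not_gr_zero)
  hence "q ^ d = q ^ e"
    using q_power_ge_2[OF *(1)] q_power_ge_2[OF *(2)] by linarith
  thus ?thesis using q_ge_2 by (simp add: power_inject_exp)
qed

text \<open>If the stabilizer has degree \<open>d\<close>, the shifts preserving the code are
  exactly the multiples of \<open>L d\<close>, so its index is \<open>L d\<close>; and
  \<open>L d\<close> determines \<open>d\<close>.\<close>

lemma quasi_cyclic_image_iff:
  assumes e: "e dvd n" and "V \<noteq> {0}"
  shows "quasi_cyclic K (q ^ n - 1) ((q ^ n - 1) div (q ^ e - 1)) (codeword ` V) \<longleftrightarrow>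
    is_subspace K V \<and> stabilizer V = fixed_field e"
proof (cases "is_subspace K V")
  case True
  obtain d where d: "d dvd n" "stabilizer V = fixed_field d"
    using stabilizer_eq_fixed_field[OF True assms(2)] .
  define L where "L d = (q ^ n - 1) div (q ^ d - 1)" for d
  have shift: "shift_invariant l (codeword ` V) \<longleftrightarrow> L d dvd l" for l
    by (simp add: shift_invariant_image_iff d alpha_power_in_fixed_field_iff L_def)
  have pos: "0 < L c" if "c dvd n" for c
  proof -
    have "q ^ n - 1 = L c * (q ^ c - 1)"
      using power_minus_1_dvd[OF that] by (simp add: L_def)
    thus ?thesis using q_power_ge_2[OF n_pos] by (intro Nat.gr0I) auto
  qed
  have "quasi_cyclic K (q ^ n - 1) (L e) (codeword ` V) \<longleftrightarrow>
      L d dvd L e \<and> (\<forall>l. 0 < l \<and> L d dvd l \<longrightarrow> L e \<le> l)"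
    by (simp add: quasi_cyclic_def shift linear_code_image_iff True pos e)
  \<comment> \<open>Minimality tested at \<open>L d\<close> gives \<open>L e \<le> L d\<close>, and
    divisibility gives the reverse inequality.\<close>
  also have "\<dots> \<longleftrightarrow> L d = L e"
    using pos[OF d(1)] pos[OF e] by (auto dest: dvd_imp_le intro: antisym)
  also have "\<dots> \<longleftrightarrow> d = e" using inj_on_shift_index[OF d(1) e] by (auto simp: L_def)
  also have "\<dots> \<longleftrightarrow> stabilizer V = fixed_field e"
    using d(2) fixed_field_subset_iff[OF d(1) e] fixed_field_subset_iff[OF e d(1)]
    by (auto intro: dvd_antisym)
  finally show ?thesis by (simp add: True L_def)
next
  case False
  then show ?thesis by (simp add: quasi_cyclic_def linear_code_image_iff)
qed

text \<open>Taking images under the injective map \<open>codeword\<close> is a bijection from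
  subsets of the field to subsets of the simplex code, and it matches the zero space with the zero
  code.\<close>

lemma card_quasi_cyclic_subcodes:
  assumes "e dvd n"
  shows "card {D. D \<subseteq> simplex_code q n \<alpha> \<and> D \<noteq> {0\<^sub>v (q ^ n - 1)} \<and>
      quasi_cyclic K (q ^ n - 1) ((q ^ n - 1) div (q ^ e - 1)) D} =
    card {V. is_subspace K V \<and> V \<noteq> {0} \<and> stabilizer V = fixed_field e}"
proof -
  have "{D. D \<subseteq> simplex_code q n \<alpha> \<and> D \<noteq> {0\<^sub>v (q ^ n - 1)} \<and>
      quasi_cyclic K (q ^ n - 1) ((q ^ n - 1) div (q ^ e - 1)) D} =
    (`) codeword ` {V. is_subspace K V \<and> V \<noteq> {0} \<and> stabilizer V = fixed_field e}"
    (is "?L = (`) codeword ` ?R")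
  proof -
    have *: "codeword ` V = {0\<^sub>v (q ^ n - 1)} \<longleftrightarrow> V = {0}" for V
      using inj_image_eq_iff[OF inj_codeword, of V "{0}"] by (simp add: codeword_zero)
    have iff: "codeword ` V \<in> ?L \<longleftrightarrow> V \<in> ?R" for V
    proof (cases "V = {0}")
      case True
      then show ?thesis by (simp add: codeword_zero)
    next
      case False
      then show ?thesis
        unfolding mem_Collect_eq quasi_cyclic_image_iff[OF assms False] *
        by (simp add: simplex_code_eq image_mono)
    qed
    have range: "D \<in> range ((`) codeword)" if "D \<in> ?L" for D
    proof -
      have "D \<subseteq> range codeword" using that unfolding simplex_code_eq by simp
      thus ?thesis unfolding subset_image_iff by blast
    qed
    show ?thesis
    proof (intro equalityI subsetI)
      fix D assume D: "D \<in> ?L"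
      from range[OF D] obtain V where V: "D = codeword ` V" by (rule rangeE)
      with D iff have "V \<in> ?R" by (simp only:)
      with V show "D \<in> (`) codeword ` ?R" by (rule image_eqI)
    next
      fix D assume "D \<in> (`) codeword ` ?R"
      then obtain V where V: "D = codeword ` V" "V \<in> ?R" by (rule imageE)
      with iff show "D \<in> ?L" by (simp only:)
    qed
  qed
  moreover have "inj_on ((`) codeword) X" for X
    using inj_image_eq_iff[OF inj_codeword] by (auto simp: inj_on_def)
  ultimately show ?thesis by (simp add: card_image)
qed

lemma card_fixed_field_subspaces:
  assumes "d dvd n"
  shows "of_nat (card {V. is_subspace (fixed_field d) V \<and> V \<noteq> {0}}) = num_subspaces (n div d) (q ^ d)"
  using card_nonzero_subspaces[OF subfield_fixed_field[of d], of "n div d"] assms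
  by (simp add: card_fixed_field card_UNIV flip: power_mult)

end

section \<open>Inclusion--exclusion\<close>

text \<open>The sum is the expansion of a product of factors -1 + 1 over \<open>T\<close>.\<close>

lemma sum_Pow_minus_one_power:
  assumes "finite T"
  shows "(\<Sum>J\<in>Pow T. (-1) ^ card J) = (if T = {} then 1 else 0 :: 'b::comm_ring_1)"
proof -
  have "(\<Sum>J\<in>Pow T. (-1) ^ card J) = (\<Prod>x\<in>T. -1 + 1 :: 'b)"
    unfolding prod_add[OF assms] by simp
  thus ?thesis using assms by (auto simp: card_gt_0_iff power_0_left)
qed

text \<open>Inclusion--exclusion with \<open>T x\<close> as the set of unwanted properties of
  \<open>x\<close>: after exchanging the sums, the inner alternating sum over the subsets of
  \<open>T x\<close> vanishes unless \<open>T x\<close> is empty.\<close>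

lemma card_filter_empty:
  assumes "finite S" "finite A" "\<And>x. x \<in> S \<Longrightarrow> T x \<subseteq> A"
  shows "of_nat (card {x \<in> S. T x = {}}) =
    (\<Sum>J\<in>Pow A. (-1) ^ card J * of_nat (card {x \<in> S. J \<subseteq> T x}) :: 'b::comm_ring_1)"
proof -
  have "(\<Sum>J\<in>Pow A. (-1) ^ card J * of_nat (card {x \<in> S. J \<subseteq> T x}) :: 'b) =
    (\<Sum>J\<in>Pow A. \<Sum>x\<in>S. if J \<subseteq> T x then (-1) ^ card J else 0)"
    using assms(1) by (simp add: sum.If_cases Int_def mult.commute)
  also have "\<dots> = (\<Sum>x\<in>S. \<Sum>J\<in>Pow A. if J \<subseteq> T x then (-1) ^ card J else 0)"
    by (rule sum.swap)
  also have "\<dots> = (\<Sum>x\<in>S. if T x = {} then 1 else 0)"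
  proof (rule sum.cong[OF refl])
    fix x assume x: "x \<in> S"
    have "Pow A \<inter> {J. J \<subseteq> T x} = Pow (T x)" using assms(3)[OF x] by auto
    thus "(\<Sum>J\<in>Pow A. if J \<subseteq> T x then (-1) ^ card J else 0 :: 'b) = (if T x = {} then 1 else 0)"
      using assms sum_Pow_minus_one_power[of "T x"] finite_subset[OF assms(3)[OF x]]
      by (simp add: sum.If_cases)
  qed
  also have "\<dots> = of_nat (card {x \<in> S. T x = {}})"
    using assms(1) by (simp add: sum.If_cases Int_def)
  finally show ?thesis ..
qed

lemma sum_Pow_by_card:
  fixes f :: "'a set \<Rightarrow> 'b::comm_monoid_add"
  assumes "finite A"
  shows "(\<Sum>J\<in>Pow A. f J) = f {} + (\<Sum>v=1..card A. \<Sum>J | J \<subseteq> A \<and> card J = v. f J)"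
proof -
  have "(\<Sum>J\<in>Pow A. f J) = (\<Sum>v=0..card A. \<Sum>J | J \<in> Pow A \<and> card J = v. f J)"
    by (rule sum.group[symmetric]) (use assms in \<open>auto intro: card_mono\<close>)
  also have "\<dots> = (\<Sum>J | J \<in> Pow A \<and> card J = 0. f J) +
      (\<Sum>v=1..card A. \<Sum>J | J \<in> Pow A \<and> card J = v. f J)"
    by (subst sum.atLeast_Suc_atMost) (simp_all add: One_nat_def)
  also have "{J. J \<in> Pow A \<and> card J = 0} = {{}}"
    using finite_subset[OF _ assms] by auto
  finally show ?thesis by simp
qed

text \<open>Distinct primes are coprime, so their divisibilities multiply; injectivity of
  \<open>u\<close> supplies the distinctness.\<close>

lemma prod_primes_dvd:
  fixes r :: nat
  assumes "finite J" "inj_on u J" "\<And>j. j \<in> J \<Longrightarrow> prime (u j)" "\<And>j. j \<in> J \<Longrightarrow> u j dvd r"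
  shows "(\<Prod>j\<in>J. u j) dvd r"
  using assms
proof (induction J)
  case (insert j J)
  have "coprime (u j) (u k)" if "k \<in> J" for k
    using insert.prems(1) insert.hyps(2) that insert.prems(2)
    by (intro primes_coprime) (auto simp: inj_on_def)
  hence "coprime (u j) (\<Prod>j\<in>J. u j)" by (rule prod_coprime_right)
  thus ?case using insert by (auto intro: divides_mult)
qed simp

theorem theorem4p1:
  fixes q n t :: nat and u a i :: "nat \<Rightarrow> nat"
    and K :: "'a::{field, finite} set" and \<alpha> :: 'a
  assumes "primepow q"
    and "\<forall>j\<in>{1..t}. prime (u j)" and "inj_on u {1..t}"
    and "n = (\<Prod>j=1..t. u j ^ a j)"
    and "card (UNIV :: 'a set) = q ^ n"
    and "is_subfield K" and "card K = q"
    and "primitive_element \<alpha>"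
    and "\<forall>j\<in>{1..t}. i j \<le> a j"
    and "\<not> (q = 2 \<and> (\<forall>j\<in>{1..t}. i j = 0))"
  shows "of_nat (card {D. D \<subseteq> simplex_code q n \<alpha> \<and> D \<noteq> {0\<^sub>v (q ^ n - 1)} \<and>
            quasi_cyclic K (q ^ n - 1) ((q ^ n - 1) div (q ^ (\<Prod>j=1..t. u j ^ i j) - 1)) D})
       = num_subspaces (\<Prod>j=1..t. u j ^ (a j - i j)) (q ^ (\<Prod>j=1..t. u j ^ i j))
         + (\<Sum>v=1..t. (-1) ^ v *
              (\<Sum>J | J \<subseteq> {1..t} \<and> card J = v. num_subspaces_over q t u a i J))"
proof -
  have prime: "prime (u j)" if "j \<in> {1..t}" for j using assms(2) that by blast
  have "0 < n" unfolding assms(4) using prime by (auto intro!: prod_pos prime_gt_0_nat)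
  then interpret finite_field_extension q n K \<alpha>
    using assms by unfold_locales
  define e where "e = (\<Prod>j=1..t. u j ^ i j)"
  define m where "m = (\<Prod>j=1..t. u j ^ (a j - i j))"
  have n: "n = e * m"
    unfolding assms(4) e_def m_def prod.distrib[symmetric]
    using assms(9) by (intro prod.cong) (auto simp flip: power_add)
  hence e: "e dvd n" and "0 < e" using \<open>0 < n\<close> by auto
  define S where "S = {V. is_subspace (fixed_field e) V \<and> V \<noteq> {0}}"
  \<comment> \<open>These are the indices \<open>j\<close> for which \<open>V\<close> is a space
    over the larger field of degree \<open>e * u j\<close>. The divisibility condition matters when
    \<open>i j = a j\<close>: then \<open>fixed_field (e * u j)\<close> is just
    \<open>fixed_field e\<close>, and \<open>j\<close> would be counted for every \<open>V\<close>
    in \<open>S\<close>.\<close>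
  define T where "T V = {j \<in> {1..t}. e * u j dvd n \<and> fixed_field (e * u j) \<subseteq> stabilizer V}" for V
  \<comment> \<open>From here on all conditions on \<open>V\<close> are read off from the degree
    \<open>d\<close> of its stabilizer, a multiple of \<open>e\<close>.\<close>
  have degree: "\<exists>d. d dvd n \<and> stabilizer V = fixed_field d \<and> is_subspace K V \<and> e dvd d \<and>
      T V = {j \<in> {1..t}. e * u j dvd d}" if "V \<in> S" for V
  proof -
    have V: "is_subspace K V" "V \<noteq> {0}" "fixed_field e \<subseteq> stabilizer V"
      using that by (auto simp: S_def is_subspace_fixed_field_iff)
    obtain d where d: "d dvd n" "stabilizer V = fixed_field d"
      using stabilizer_eq_fixed_field[OF V(1,2)] .
    have "e dvd d" using V(3) fixed_field_subset_iff[OF e d(1)] d(2) by simp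
    moreover have "T V = {j \<in> {1..t}. e * u j dvd d}"
      unfolding T_def d(2) using fixed_field_subset_iff[OF _ d(1)] dvd_trans[OF _ d(1)] by auto
    ultimately show ?thesis using d V by blast
  qed
  have "{V. is_subspace K V \<and> V \<noteq> {0} \<and> stabilizer V = fixed_field e} = {V \<in> S. T V = {}}"
  proof -
    have "stabilizer V = fixed_field e \<longleftrightarrow> T V = {}" if V: "V \<in> S" for V
    proof -
      obtain d where d: "d dvd n" "stabilizer V = fixed_field d" "e dvd d"
        "T V = {j \<in> {1..t}. e * u j dvd d}" using degree[OF V] by blast
      have "stabilizer V = fixed_field e \<longleftrightarrow> d = e"
        using fixed_field_subset_iff[OF d(1) e] fixed_field_subset_iff[OF e d(1)]
        by (auto simp: d(2) intro: dvd_antisym)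
      also have "\<dots> \<longleftrightarrow> T V = {}"
      proof
        assume "d = e"
        show "T V = {}"
          using prime[THEN prime_gt_1_nat] \<open>0 < e\<close> by (fastforce simp: d(4) \<open>d = e\<close>)
      next
        assume empty: "T V = {}"
        \<comment> \<open>If the quotient \<open>r\<close> is not 1, it has a prime factor; that
          prime divides \<open>n\<close>, so it is some \<open>u j\<close>, and this
          \<open>j\<close> lies in \<open>T V\<close>.\<close>
        obtain r where r: "d = e * r" using d(3) by auto
        show "d = e"
        proof (rule ccontr)
          assume "d \<noteq> e"
          hence "r \<noteq> 1" using r by auto
          then obtain p where p: "prime p" "p dvd r" using prime_factor_nat by blast
          have "p dvd n" using p(2) d(1) r by (meson dvd_mult dvd_trans)
          then obtain j where j: "j \<in> {1..t}" "p dvd u j ^ a j"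
            unfolding assms(4) using prime_dvd_prod_iff[of "{1..t}" p] p(1) by auto
          hence "p = u j"
            using p(1) prime by (metis prime_dvd_power primes_dvd_imp_eq)
          hence "j \<in> T V" using j p(2) by (auto simp: d(4) r)
          thus False using empty by blast
        qed
      qed
      finally show ?thesis .
    qed
    moreover have "V \<in> S" if "is_subspace K V" "V \<noteq> {0}" "stabilizer V = fixed_field e" for V
      using that by (simp add: S_def is_subspace_fixed_field_iff)
    moreover have "is_subspace K V" "V \<noteq> {0}" if "V \<in> S" for V
      using that by (auto simp: S_def is_subspace_fixed_field_iff)
    ultimately show ?thesis by blast
  qed
  moreover have "of_nat (card {V \<in> S. J \<subseteq> T V}) = num_subspaces_over q t u a i J"
    if J: "J \<subseteq> {1..t}" for J
  proof (cases "\<forall>j\<in>J. i j + 1 \<le> a j")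
    case True
    have split: "(\<Prod>j=1..t. g j) = (\<Prod>j\<in>J. g j) * (\<Prod>j\<in>{1..t} - J. g j)" for g :: "nat \<Rightarrow> nat"
      using prod.subset_diff[OF J, of g] by (simp add: mult.commute)
    \<comment> \<open>\<open>f\<close> is the degree of the field generated by the fields of degree
      \<open>e * u j\<close> for \<open>j\<close> in \<open>J\<close>, and \<open>l\<close> is the
      complementary factor \<open>n div f\<close>, the dimension over it.\<close>
    define f where "f = (\<Prod>j\<in>J. u j ^ (i j + 1)) * (\<Prod>\<mu>\<in>{1..t} - J. u \<mu> ^ i \<mu>)"
    define l where "l = (\<Prod>j\<in>J. u j ^ (a j - i j - 1)) * (\<Prod>\<mu>\<in>{1..t} - J. u \<mu> ^ (a \<mu> - i \<mu>))"
    have f: "f = e * (\<Prod>j\<in>J. u j)"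
      unfolding f_def e_def split by (simp add: power_add prod.distrib mult_ac)
    have "m = (\<Prod>j\<in>J. u j) * l"
    proof -
      have "(\<Prod>j\<in>J. u j ^ (a j - i j)) = (\<Prod>j\<in>J. u j) * (\<Prod>j\<in>J. u j ^ (a j - i j - 1))"
        unfolding prod.distrib[symmetric]
      proof (rule prod.cong[OF refl])
        fix j assume "j \<in> J"
        \<comment> \<open>The case assumption makes \<open>a j - i j\<close> positive, so
          subtracting 1 does not truncate.\<close>
        hence "a j - i j = Suc (a j - i j - 1)" using True by force
        thus "u j ^ (a j - i j) = u j * u j ^ (a j - i j - 1)" by (metis power_Suc)
      qed
      thus ?thesis unfolding m_def l_def split by simp
    qed
    hence fl: "n = f * l" by (simp add: n f)
    hence "f dvd n" "0 < f" using \<open>0 < n\<close> by auto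
    have "{V \<in> S. J \<subseteq> T V} = {V. is_subspace (fixed_field f) V \<and> V \<noteq> {0}}"
    proof (intro equalityI subsetI)
      fix V assume "V \<in> {V \<in> S. J \<subseteq> T V}"
      hence V: "V \<in> S" "J \<subseteq> T V" by auto
      obtain d where d: "d dvd n" "stabilizer V = fixed_field d" "is_subspace K V" "e dvd d"
        "T V = {j \<in> {1..t}. e * u j dvd d}" using degree[OF V(1)] by blast
      obtain r where r: "d = e * r" using d(4) by auto
      \<comment> \<open>Each \<open>u j\<close> with \<open>j\<close> in \<open>J\<close> divides
        \<open>r = d / e\<close>; being distinct primes, so does their product, and \<open>f\<close>
        divides \<open>d\<close>.\<close>
      have "(\<Prod>j\<in>J. u j) dvd r"
      proof (rule prod_primes_dvd)
        show "finite J" using J finite_subset by blast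
        show "inj_on u J" using J assms(3) inj_on_subset by blast
      qed (use J prime V(2) \<open>0 < e\<close> in \<open>auto simp: d(5) r\<close>)
      hence "f dvd d" by (simp add: f r)
      hence "fixed_field f \<subseteq> stabilizer V" unfolding d(2) by (rule fixed_field_mono)
      thus "V \<in> {V. is_subspace (fixed_field f) V \<and> V \<noteq> {0}}"
        using d(3) V(1) by (auto simp: S_def is_subspace_fixed_field_iff)
    next
      fix V assume "V \<in> {V. is_subspace (fixed_field f) V \<and> V \<noteq> {0}}"
      hence V: "is_subspace K V" "fixed_field f \<subseteq> stabilizer V" "V \<noteq> {0}"
        by (auto simp: is_subspace_fixed_field_iff)
      have "fixed_field e \<subseteq> fixed_field f" by (rule fixed_field_mono) (simp add: f)
      hence "V \<in> S" using V by (auto simp: S_def is_subspace_fixed_field_iff)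
      moreover have "j \<in> T V" if j: "j \<in> J" for j
      proof -
        have "e * u j dvd f"
          unfolding f using j J finite_subset[OF J] by (intro mult_dvd_mono dvd_prodI) auto
        thus ?thesis
          using j J V(2) fixed_field_mono[of "e * u j" f] dvd_trans[OF _ \<open>f dvd n\<close>]
          by (auto simp: T_def)
      qed
      ultimately show "V \<in> {V \<in> S. J \<subseteq> T V}" by blast
    qed
    hence "of_nat (card {V \<in> S. J \<subseteq> T V}) = num_subspaces l (q ^ f)"
      using card_fixed_field_subspaces[OF \<open>f dvd n\<close>] \<open>0 < f\<close> by (simp add: fl)
    thus ?thesis using True by (simp add: num_subspaces_over_def f_def l_def)
  next
    case False
    then obtain j where j: "j \<in> J" "a j < i j + 1" by auto
    hence uj: "prime (u j)" using prime J by blast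
    \<comment> \<open>Here \<open>u j\<close> has exponent 0 in \<open>m = n / e\<close>, so
      \<open>j\<close> belongs to no \<open>T V\<close>. The count is therefore 0, which is the
      default value in \<open>num_subspaces_over\<close>.\<close>
    have "\<not> e * u j dvd n"
    proof
      assume "e * u j dvd n"
      hence "u j dvd m" using \<open>0 < e\<close> by (simp add: n)
      then obtain k where k: "k \<in> {1..t}" "u j dvd u k ^ (a k - i k)"
        unfolding m_def using uj by (auto simp: prime_dvd_prod_iff)
      hence "u j = u k" using uj prime by (metis prime_dvd_power primes_dvd_imp_eq)
      hence "j = k" using assms(3) k(1) j(1) J by (auto dest: inj_onD)
      hence "u j dvd 1" using k(2) j(2) by simp
      thus False using uj by (metis not_prime_unit)
    qed
    hence empty: "{V \<in> S. J \<subseteq> T V} = {}" using j(1) by (auto simp: T_def)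
    show ?thesis
      unfolding empty num_subspaces_over_def if_not_P[OF False] by simp
  qed
  moreover have "of_nat (card {V \<in> S. T V = {}}) =
      (\<Sum>J\<in>Pow {1..t}. (-1) ^ card J * of_nat (card {V \<in> S. J \<subseteq> T V}) :: rat)"
    by (rule card_filter_empty) (auto simp: T_def)
  ultimately have "of_nat (card {V. is_subspace K V \<and> V \<noteq> {0} \<and> stabilizer V = fixed_field e}) =
      (\<Sum>J\<in>Pow {1..t}. (-1) ^ card J * num_subspaces_over q t u a i J)"
    by simp
  \<comment> \<open>Grouping by the size of \<open>J\<close> isolates the empty set, whose term is
    the leading summand of the formula.\<close>
  also have "\<dots> = num_subspaces_over q t u a i {} + (\<Sum>v=1..t. \<Sum>J | J \<subseteq> {1..t} \<and> card J = v.
      (-1) ^ card J * num_subspaces_over q t u a i J)"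
    by (subst sum_Pow_by_card) simp_all
  also have "\<dots> = num_subspaces m (q ^ e) + (\<Sum>v=1..t. (-1) ^ v *
      (\<Sum>J | J \<subseteq> {1..t} \<and> card J = v. num_subspaces_over q t u a i J))"
    by (simp add: num_subspaces_over_def m_def e_def sum_distrib_left)
  finally show ?thesis
    unfolding card_quasi_cyclic_subcodes[OF e, folded e_def] m_def[symmetric] e_def[symmetric] .
qed

end
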